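(* Let $(X,\rho)$ be a compact metric space. For $\mu_1,\mu_2\in I(X)$ put $$\rho_I(\mu_1,\mu_2)=\inf\Big\{\sup\{\max\{\xi(\rho),\rho(x,y)\}:\ (x,y)\in\operatorname{supp}\xi\}:\ \xi\in\Lambda(\mu_1,\mu_2)\Big\}.$$ Then $\rho_I$ is a metric on $I(X)$ which is an extension of the metric $\rho$, i.e. $\rho_I(\delta_x,\delta_y)=\rho(x,y)$ for all $x,y\in X$.
   Context: For a compact Hausdorff space $X$, $C(X)$ is the set of continuous functions $X\to\mathbb{R}$. An idempotent probability measure on $X$ is a functional $\mu:C(X)\to\mathbb{R}$ such that (1) $\mu(\lambda_X)=\lambda$ for every $\lambda\in\mathbb{R}$, where $\lambda_X$ is the constant function with value $\lambda$; (2) $\mu(\lambda+\varphi)=\lambda+\mu(\varphi)$ for all $\lambda\in\mathbb{R}$, $\varphi\in C(X)$; (3) $\mu(\max\{\varphi,\psi\})=\max\{\mu(\varphi),\mu(\psi)\}$ for all $\varphi,\psi\in C(X)$. $I(X)$ is the set of all idempotent probability measures on $X$. For $x\in X$, $\delta_x\in I(X)$ is the Dirac measure $\delta_x(\varphi)=\varphi(x)$; $X$ is regarded as a subset of $I(X)$ via $x\mapsto\delta_x$. For a continuous map $f:X\to Y$ of compact Hausdorff spaces, $I(f):I(X)\to I(Y)$ is defined by $I(f)(\mu)(\psi)=\mu(\psi\circ f)$, $\psi\in C(Y)$. For closed $A\subset X$, $I(A)$ is identified with the image of $I(i_A)$ in $I(X)$, where $i_A:A\to X$ is the inclusion. The support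 of $\mu\in I(X)$ is $\operatorname{supp}\mu=\bigcap\{A\subset X: A \text{ closed},\ \mu\in I(A)\}$. Let $\pi_i:X\times X\to X$ be the projection onto the $i$-th factor, $i=1,2$. For $\mu_1,\mu_2\in I(X)$, $\Lambda(\mu_1,\mu_2)=\{\xi\in I(X\times X): I(\pi_i)(\xi)=\mu_i,\ i=1,2\}$; this set is nonempty. The metric $\rho$ is regarded as an element of $C(X\times X)$, so $\xi(\rho)$ makes sense for $\xi\in I(X\times X)$. *)

theory Defs
  imports "HOL-Analysis.Analysis"
begin

text \<open>
  Functions on a space and functionals on a function space are represented by extensional
  functions (undefined outside the domain), so that equality of functionals is the
  mathematical equality.
\<close>

definition cont_funs :: "'a topology \<Rightarrow> ('a \<Rightarrow> real) set" where
  "cont_funs X = {\<phi> \<in> extensional (topspace X). continuous_map X euclideanreal \<phi>}"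

definition idem_measures :: "'a topology \<Rightarrow> (('a \<Rightarrow> real) \<Rightarrow> real) set" where
  "idem_measures X = {\<mu> \<in> extensional (cont_funs X).
     (\<forall>c::real. \<mu> (\<lambda>x\<in>topspace X. c) = c) \<and>
     (\<forall>c::real. \<forall>\<phi>\<in>cont_funs X. \<mu> (\<lambda>x\<in>topspace X. c + \<phi> x) = c + \<mu> \<phi>) \<and>
     (\<forall>\<phi>\<in>cont_funs X. \<forall>\<psi>\<in>cont_funs X.
        \<mu> (\<lambda>x\<in>topspace X. max (\<phi> x) (\<psi> x)) = max (\<mu> \<phi>) (\<mu> \<psi>))}"

definition dirac :: "'a topology \<Rightarrow> 'a \<Rightarrow> ('a \<Rightarrow> real) \<Rightarrow> real" where
  "dirac X x = (\<lambda>\<phi>\<in>cont_funs X. \<phi> x)"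

definition idem_map ::
  "'a topology \<Rightarrow> 'b topology \<Rightarrow> ('a \<Rightarrow> 'b) \<Rightarrow> (('a \<Rightarrow> real) \<Rightarrow> real) \<Rightarrow> ('b \<Rightarrow> real) \<Rightarrow> real" where
  "idem_map X Y f \<mu> = (\<lambda>\<psi>\<in>cont_funs Y. \<mu> (compose (topspace X) \<psi> f))"

text \<open>The measures on \<open>X\<close> coming from the subspace \<open>A\<close>; here \<open>id\<close> is the inclusion.\<close>

definition idem_measures_in :: "'a topology \<Rightarrow> 'a set \<Rightarrow> (('a \<Rightarrow> real) \<Rightarrow> real) set" where
  "idem_measures_in X A = idem_map (subtopology X A) X id ` idem_measures (subtopology X A)"

definition idem_supp :: "'a topology \<Rightarrow> (('a \<Rightarrow> real) \<Rightarrow> real) \<Rightarrow> 'a set" where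
  "idem_supp X \<mu> = \<Inter> {A. closedin X A \<and> \<mu> \<in> idem_measures_in X A}"

definition couplings ::
  "'a topology \<Rightarrow> (('a \<Rightarrow> real) \<Rightarrow> real) \<Rightarrow> (('a \<Rightarrow> real) \<Rightarrow> real) \<Rightarrow> (('a \<times> 'a \<Rightarrow> real) \<Rightarrow> real) set" where
  "couplings X \<mu>1 \<mu>2 = {\<xi> \<in> idem_measures (prod_topology X X).
     idem_map (prod_topology X X) X fst \<xi> = \<mu>1 \<and> idem_map (prod_topology X X) X snd \<xi> = \<mu>2}"

text \<open>
  The value \<open>0\<close> off the set of idempotent measures is a convention:
  \<^const>\<open>Metric_space\<close> requires nonnegativity and symmetry also outside the carrier.
\<close>

definition rho_I ::
  "'a set \<Rightarrow> ('a \<Rightarrow> 'a \<Rightarrow> real) \<Rightarrow> (('a \<Rightarrow> real) \<Rightarrow> real) \<Rightarrow> (('a \<Rightarrow> real) \<Rightarrow> real) \<Rightarrow> real" where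
  "rho_I X \<rho> \<mu>1 \<mu>2 =
     (let T = Metric_space.mtopology X \<rho> in
      if \<mu>1 \<in> idem_measures T \<and> \<mu>2 \<in> idem_measures T
      then INF \<xi> \<in> couplings T \<mu>1 \<mu>2.
             SUP (x, y) \<in> idem_supp (prod_topology T T) \<xi>.
               max (\<xi> (\<lambda>(x, y) \<in> X \<times> X. \<rho> x y)) (\<rho> x y)
      else 0)"

end

theory Submission
  imports Defs
begin

text \<open>
  An idempotent measure is the max-plus analogue of an integral: \<open>\<mu>\<close> has an upper semicontinuous
  density \<open>\<lambda>\<^sub>\<mu> : X \<rightarrow> [-\<infinity>, 0]\<close> with \<open>\<mu> \<phi> = max\<^sub>p (\<lambda>\<^sub>\<mu> p + \<phi> p)\<close>, namely
  \<open>\<lambda>\<^sub>\<mu> p = inf\<^sub>\<phi> (\<mu> \<phi> - \<phi> p)\<close>. That the maximum is attained follows from compactness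
  (\<open>idem_measure_attained\<close>); the density vanishes, i.e. equals \<open>-\<infinity>\<close>, off the support
  (\<open>density_ge_imp_supp\<close>). Values \<open>-\<infinity>\<close> are avoided by working only with the relation
  \<open>c \<le> \<lambda>\<^sub>\<mu> p\<close> for real \<open>c\<close>, written \<open>density_ge T \<mu> p c\<close>.

  First, \<open>\<xi>(\<rho>) = \<lambda>\<^sub>\<xi> p + \<rho> p \<le> \<rho> p\<close> for some \<open>p\<close> in the support of \<open>\<xi>\<close>, so over the
  support \<open>max {\<xi>(\<rho>), \<rho>}\<close> has the same supremum as \<open>\<rho>\<close> (\<open>supp_cost_le_iff\<close>). Hence \<open>\<rho>\<^sub>I(\<mu>,\<nu>)\<close> is the infimum of the
  \<open>r\<close> for which some coupling of \<open>\<mu>\<close> and \<open>\<nu>\<close> lives on \<open>{\<rho> \<le> r}\<close>.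

  Next, couplings can be eliminated. The largest density on \<open>{\<rho> \<le> r}\<close> whose marginals do not
  exceed \<open>\<lambda>\<^sub>\<mu>\<close> and \<open>\<lambda>\<^sub>\<nu>\<close> is \<open>min (\<lambda>\<^sub>\<mu> x) (\<lambda>\<^sub>\<nu> y)\<close>. It is a coupling as soon as every point \<open>x\<close> with
  \<open>\<lambda>\<^sub>\<mu> x \<ge> c\<close> has a point \<open>y\<close> within distance \<open>r\<close> with \<open>\<lambda>\<^sub>\<nu> y \<ge> c\<close>, and the same
  holds with \<open>\<mu>\<close> and \<open>\<nu>\<close> exchanged (\<open>coupling_exists\<close>). This two-sided condition says that for every \<open>c\<close> the superlevel sets
  \<open>{\<lambda>\<^sub>\<mu> \<ge> c}\<close> and \<open>{\<lambda>\<^sub>\<nu> \<ge> c}\<close> are within Hausdorff distance \<open>r\<close>. Conversely, any coupling whose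
  support lies in \<open>{\<rho> \<le> s}\<close> yields the condition for all \<open>r > s\<close> (\<open>coupling_dominated_within\<close>). So \<open>\<rho>\<^sub>I\<close> is the supremum
  over \<open>c \<le> 0\<close> of Hausdorff distances of superlevel sets: symmetry is built in, the triangle inequality
  is composition of the conditions, and \<open>\<rho>\<^sub>I(\<mu>,\<nu>) = 0\<close> forces equal
  densities because superlevel sets are closed. The density of \<open>\<delta>\<^sub>x\<close> is \<open>0\<close> at \<open>x\<close> and \<open>-\<infinity>\<close> elsewhere,
  which gives \<open>\<rho>\<^sub>I(\<delta>\<^sub>x,\<delta>\<^sub>y) = \<rho>(x,y)\<close>.
\<close>

section \<open>Idempotent measures and their densities\<close>

lemma restrict_mem_cont_funs:
  "continuous_map T euclideanreal f \<Longrightarrow> restrict f (topspace T) \<in> cont_funs T"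
  unfolding cont_funs_def by (auto intro: continuous_map_eq)

lemma cont_funs_continuous: "\<phi> \<in> cont_funs T \<Longrightarrow> continuous_map T euclideanreal \<phi>"
  by (simp add: cont_funs_def)

lemma cont_funs_restrict: "\<phi> \<in> cont_funs T \<Longrightarrow> restrict \<phi> (topspace T) = \<phi>"
  by (simp add: cont_funs_def extensional_restrict)

lemma cont_funs_compose:
  assumes "continuous_map S T f" "\<psi> \<in> cont_funs T"
  shows "compose (topspace S) \<psi> f \<in> cont_funs S"
proof -
  have "continuous_map S euclideanreal (\<lambda>x. \<psi> (f x))"
    using continuous_map_compose[OF assms(1) cont_funs_continuous[OF assms(2)]] by (simp add: o_def)
  then show ?thesis
    unfolding compose_def by (rule restrict_mem_cont_funs)
qed

lemma cont_funs_bounded_above: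
  assumes "compact_space T" "\<phi> \<in> cont_funs T"
  shows "\<exists>B. \<forall>x\<in>topspace T. \<phi> x \<le> B"
proof -
  have "compact (\<phi> ` topspace T)"
    using image_compactin[OF _ cont_funs_continuous[OF assms(2)]] assms(1)
    by (simp add: compact_space_def)
  then have "bdd_above (\<phi> ` topspace T)"
    by (intro bounded_imp_bdd_above compact_imp_bounded)
  then show ?thesis
    unfolding bdd_above_def by blast
qed

lemma idem_measures_const: "\<mu> \<in> idem_measures T \<Longrightarrow> \<mu> (\<lambda>x\<in>topspace T. c) = c"
  by (simp add: idem_measures_def)

lemma idem_measures_add:
  "\<mu> \<in> idem_measures T \<Longrightarrow> \<phi> \<in> cont_funs T \<Longrightarrow> \<mu> (\<lambda>x\<in>topspace T. c + \<phi> x) = c + \<mu> \<phi>"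
  by (simp add: idem_measures_def)

lemma idem_measures_max:
  "\<mu> \<in> idem_measures T \<Longrightarrow> \<phi> \<in> cont_funs T \<Longrightarrow> \<psi> \<in> cont_funs T \<Longrightarrow>
    \<mu> (\<lambda>x\<in>topspace T. max (\<phi> x) (\<psi> x)) = max (\<mu> \<phi>) (\<mu> \<psi>)"
  by (simp add: idem_measures_def)

lemma idem_measures_mono:
  assumes "\<mu> \<in> idem_measures T" "\<phi> \<in> cont_funs T" "\<psi> \<in> cont_funs T"
    and le: "\<And>x. x \<in> topspace T \<Longrightarrow> \<phi> x \<le> \<psi> x"
  shows "\<mu> \<phi> \<le> \<mu> \<psi>"
proof -
  have "(\<lambda>x\<in>topspace T. max (\<phi> x) (\<psi> x)) = (\<lambda>x\<in>topspace T. \<psi> x)"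
    by (rule restrict_ext) (use le in auto)
  then show ?thesis
    using idem_measures_max[OF assms(1-3)] cont_funs_restrict[OF assms(3)] by simp
qed

text \<open>
  The relation \<open>c \<le> \<lambda>\<^sub>\<mu> p\<close> for the density \<open>\<lambda>\<^sub>\<mu> p = inf\<^sub>\<phi> (\<mu> \<phi> - \<phi> p)\<close>, so that the value \<open>-\<infinity>\<close> appears
  as the absence of any such \<open>c\<close>.
\<close>

definition density_ge :: "'a topology \<Rightarrow> (('a \<Rightarrow> real) \<Rightarrow> real) \<Rightarrow> 'a \<Rightarrow> real \<Rightarrow> bool" where
  "density_ge T \<mu> p c \<longleftrightarrow> p \<in> topspace T \<and> (\<forall>\<phi>\<in>cont_funs T. c + \<phi> p \<le> \<mu> \<phi>)"

lemma density_ge_topspace: "density_ge T \<mu> p c \<Longrightarrow> p \<in> topspace T"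
  by (simp add: density_ge_def)

lemma density_geD: "density_ge T \<mu> p c \<Longrightarrow> \<phi> \<in> cont_funs T \<Longrightarrow> c + \<phi> p \<le> \<mu> \<phi>"
  by (simp add: density_ge_def)

lemma density_ge_continuous_map:
  assumes "density_ge T \<mu> p c" "continuous_map T euclideanreal f"
  shows "c + f p \<le> \<mu> (restrict f (topspace T))"
  using density_geD[OF assms(1) restrict_mem_cont_funs[OF assms(2)]] density_ge_topspace[OF assms(1)]
  by simp

lemma density_ge_mono: "density_ge T \<mu> p c \<Longrightarrow> c' \<le> c \<Longrightarrow> density_ge T \<mu> p c'"
  unfolding density_ge_def by fastforce

lemma density_ge_nonpos:
  assumes "\<mu> \<in> idem_measures T" "density_ge T \<mu> p c"
  shows "c \<le> 0"
  using density_ge_continuous_map[OF assms(2), of "\<lambda>_. 0"] idem_measures_const[OF assms(1), of 0]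
  by simp

text \<open>
  Maxitivity extends to finite families; the empty one is included by starting from the constant
  \<open>b - 1\<close>, which also settles the empty space in the compactness argument below.
\<close>

lemma idem_measures_finite_max:
  assumes \<mu>: "\<mu> \<in> idem_measures T" and "finite \<Theta>"
    and "\<And>\<theta>. \<theta> \<in> \<Theta> \<Longrightarrow> \<theta> \<in> cont_funs T \<and> \<mu> \<theta> < b"
  shows "\<exists>G\<in>cont_funs T. \<mu> G < b \<and> (\<forall>\<theta>\<in>\<Theta>. \<forall>x\<in>topspace T. \<theta> x \<le> G x)"
  using assms(2,3)
proof (induction \<Theta> rule: finite_induct)
  case empty
  have "(\<lambda>x\<in>topspace T. b - 1) \<in> cont_funs T"
    by (rule restrict_mem_cont_funs) simp
  then show ?case
    using idem_measures_const[OF \<mu>, of "b - 1"] by force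
next
  case (insert \<theta> \<Theta>)
  then obtain G where G: "G \<in> cont_funs T" "\<mu> G < b" "\<forall>\<theta>\<in>\<Theta>. \<forall>x\<in>topspace T. \<theta> x \<le> G x"
    by auto
  have \<theta>: "\<theta> \<in> cont_funs T" "\<mu> \<theta> < b"
    using insert.prems by auto
  let ?H = "\<lambda>x\<in>topspace T. max (\<theta> x) (G x)"
  have "?H \<in> cont_funs T"
    by (intro restrict_mem_cont_funs continuous_map_real_max cont_funs_continuous \<theta> G)
  moreover have "\<mu> ?H < b"
    using idem_measures_max[OF \<mu> \<theta>(1) G(1)] \<theta> G by simp
  moreover have "\<forall>\<eta>\<in>insert \<theta> \<Theta>. \<forall>x\<in>topspace T. \<eta> x \<le> ?H x"
    using G(3) by (auto simp: le_max_iff_disj)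
  ultimately show ?case by blast
qed

text \<open>
  The max-plus representation \<open>\<mu> \<phi> = max\<^sub>p (\<lambda>\<^sub>\<mu> p + \<phi> p)\<close>. If it failed, every point \<open>p\<close> would carry a
  function \<open>\<theta>\<close> exceeding \<open>\<phi>\<close> near \<open>p\<close> with \<open>\<mu> \<theta> < \<mu> \<phi>\<close>; the maximum of finitely many of them
  exceeds \<open>\<phi>\<close> everywhere but has smaller measure, against monotonicity.
\<close>

lemma idem_measure_attained:
  assumes T: "compact_space T" and \<mu>: "\<mu> \<in> idem_measures T" and \<phi>: "\<phi> \<in> cont_funs T"
  shows "\<exists>p. density_ge T \<mu> p (\<mu> \<phi> - \<phi> p)"
proof (rule ccontr)
  assume none: "\<nexists>p. density_ge T \<mu> p (\<mu> \<phi> - \<phi> p)"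
  have "\<exists>\<theta>. \<theta> \<in> cont_funs T \<and> \<mu> \<theta> < \<mu> \<phi> \<and> \<phi> p < \<theta> p" if p: "p \<in> topspace T" for p
  proof -
    obtain \<psi> where \<psi>: "\<psi> \<in> cont_funs T" "\<mu> \<psi> < \<mu> \<phi> - \<phi> p + \<psi> p"
      using none p unfolding density_ge_def by force
    \<comment> \<open>Any shift in this gap lifts \<open>\<psi>\<close> above \<open>\<phi>\<close> at \<open>p\<close> while keeping its measure below \<open>\<mu> \<phi>\<close>.\<close>
    then obtain k where k: "\<phi> p - \<psi> p < k" "k < \<mu> \<phi> - \<mu> \<psi>"
      using dense[of "\<phi> p - \<psi> p" "\<mu> \<phi> - \<mu> \<psi>"] by auto
    let ?\<theta> = "\<lambda>x\<in>topspace T. k + \<psi> x"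
    have "?\<theta> \<in> cont_funs T"
      by (intro restrict_mem_cont_funs continuous_intros cont_funs_continuous \<psi>) simp
    then show ?thesis
      using idem_measures_add[OF \<mu> \<psi>(1), of k] k p by (intro exI[of _ ?\<theta>]) auto
  qed
  then obtain \<theta> where \<theta>: "\<And>p. p \<in> topspace T \<Longrightarrow> \<theta> p \<in> cont_funs T \<and> \<mu> (\<theta> p) < \<mu> \<phi> \<and> \<phi> p < \<theta> p p"
    by metis
  define U where "U p = {x \<in> topspace T. \<theta> p x - \<phi> x \<in> {0<..}}" for p
  have open_U: "openin T (U p)" if "p \<in> topspace T" for p
    unfolding U_def
  proof (rule openin_continuous_map_preimage)
    show "continuous_map T euclideanreal (\<lambda>x. \<theta> p x - \<phi> x)"
      using \<theta>[OF that] \<phi> by (intro continuous_intros cont_funs_continuous) auto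
  qed auto
  have "topspace T \<subseteq> \<Union> (U ` topspace T)"
    using \<theta> by (auto simp: U_def)
  then obtain \<F> where "finite \<F>" "\<F> \<subseteq> U ` topspace T" "topspace T \<subseteq> \<Union> \<F>"
    using compactinD[of T "topspace T" "U ` topspace T"] T open_U
    unfolding compact_space_def by blast
  then obtain P where P: "finite P" "P \<subseteq> topspace T" "topspace T \<subseteq> \<Union> (U ` P)"
    by (metis finite_subset_image)
  obtain G where G: "G \<in> cont_funs T" "\<mu> G < \<mu> \<phi>" "\<forall>\<eta>\<in>\<theta> ` P. \<forall>x\<in>topspace T. \<eta> x \<le> G x"
    using idem_measures_finite_max[OF \<mu>, of "\<theta> ` P" "\<mu> \<phi>"] P(1,2) \<theta> by (auto simp: subset_iff)
  have "\<phi> x \<le> G x" if x: "x \<in> topspace T" for x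
  proof -
    obtain p where "p \<in> P" "x \<in> U p"
      using subsetD[OF P(3) x] by (elim UN_E)
    then show ?thesis
      using G(3) x unfolding U_def by fastforce
  qed
  then have "\<mu> \<phi> \<le> \<mu> G"
    by (rule idem_measures_mono[OF \<mu> \<phi> G(1)])
  then show False
    using G(2) by simp
qed

text \<open>The normalisation \<open>max \<lambda>\<^sub>\<mu> = 0\<close>, read off from the representation of \<open>\<mu> 0 = 0\<close>.\<close>

lemma density_ge_zero_exists:
  assumes "compact_space T" "\<mu> \<in> idem_measures T"
  shows "\<exists>p. density_ge T \<mu> p 0"
proof -
  have "(\<lambda>x\<in>topspace T. 0) \<in> cont_funs T"
    by (rule restrict_mem_cont_funs) simp
  then obtain p where "density_ge T \<mu> p (\<mu> (\<lambda>x\<in>topspace T. 0) - (\<lambda>x\<in>topspace T. 0) p)"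
    using idem_measure_attained[OF assms] by blast
  then have "density_ge T \<mu> p 0"
    using density_ge_topspace idem_measures_const[OF assms(2), of 0] by fastforce
  then show ?thesis ..
qed

lemma idem_measure_eqI:
  assumes T: "compact_space T" and \<mu>: "\<mu> \<in> idem_measures T" and \<nu>: "\<nu> \<in> idem_measures T"
    and eq: "\<And>p c. density_ge T \<mu> p c \<longleftrightarrow> density_ge T \<nu> p c"
  shows "\<mu> = \<nu>"
proof (rule extensionalityI)
  show "\<mu> \<in> extensional (cont_funs T)" "\<nu> \<in> extensional (cont_funs T)"
    using \<mu> \<nu> by (auto simp: idem_measures_def)
  fix \<phi> assume \<phi>: "\<phi> \<in> cont_funs T"
  obtain p where "density_ge T \<nu> p (\<mu> \<phi> - \<phi> p)"
    using idem_measure_attained[OF T \<mu> \<phi>] eq by blast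
  moreover obtain q where "density_ge T \<mu> q (\<nu> \<phi> - \<phi> q)"
    using idem_measure_attained[OF T \<nu> \<phi>] eq by blast
  ultimately show "\<mu> \<phi> = \<nu> \<phi>"
    using density_geD[of T \<nu> p _ \<phi>] density_geD[of T \<mu> q _ \<phi>] \<phi> by fastforce
qed

text \<open>
  If \<open>\<mu>\<close> comes from a closed set \<open>A\<close>, it cannot see a function vanishing on \<open>A\<close>; a Urysohn function
  that is large at a point \<open>p\<close> outside \<open>A\<close> therefore pushes the density at \<open>p\<close> below every bound.
\<close>

lemma density_ge_imp_supp:
  assumes T: "completely_regular_space T" and p: "density_ge T \<mu> p c"
  shows "p \<in> idem_supp T \<mu>"
  unfolding idem_supp_def
proof (rule InterI, clarify)
  fix A assume A: "closedin T A" "\<mu> \<in> idem_measures_in T A"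
  show "p \<in> A"
  proof (rule ccontr)
    assume "p \<notin> A"
    then obtain f where f: "continuous_map T (top_of_set {0..1::real}) f" "f p = 0" "f ` A \<subseteq> {1}"
      using T A(1) density_ge_topspace[OF p] unfolding completely_regular_space_def by blast
    \<comment> \<open>Zero on \<open>A\<close> and \<open>1 - c\<close> at \<open>p\<close>, just enough to contradict the bound \<open>c + g p \<le> 0\<close>.\<close>
    define g where "g x = (1 - c) * (1 - f x)" for x
    have "continuous_map T euclideanreal f"
      using f(1) continuous_map_into_fulltopology by blast
    then have g: "continuous_map T euclideanreal g"
      unfolding g_def by (intro continuous_intros) auto
    obtain \<nu> where \<nu>: "\<nu> \<in> idem_measures (subtopology T A)" "\<mu> = idem_map (subtopology T A) T id \<nu>"
      using A(2) unfolding idem_measures_in_def by blast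
    have "compose (topspace (subtopology T A)) (restrict g (topspace T)) id
        = (\<lambda>x\<in>topspace (subtopology T A). 0)"
      unfolding compose_def by (rule restrict_ext) (use f(3) in \<open>auto simp: g_def\<close>)
    then have "\<mu> (restrict g (topspace T)) = 0"
      using \<nu> restrict_mem_cont_funs[OF g] idem_measures_const[OF \<nu>(1), of 0]
      by (simp add: idem_map_def)
    then show False
      using density_ge_continuous_map[OF p g] by (simp add: g_def f(2))
  qed
qed

lemma density_ge_idem_map:
  assumes "continuous_map S T f" "density_ge S \<xi> p c"
  shows "density_ge T (idem_map S T f \<xi>) (f p) c"
  unfolding density_ge_def
proof (intro conjI ballI)
  have p: "p \<in> topspace S"
    using density_ge_topspace[OF assms(2)] .
  then show "f p \<in> topspace T"
    using continuous_map_image_subset_topspace[OF assms(1)] by blast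
  fix \<phi> assume \<phi>: "\<phi> \<in> cont_funs T"
  show "c + \<phi> (f p) \<le> idem_map S T f \<xi> \<phi>"
    using density_geD[OF assms(2) cont_funs_compose[OF assms(1) \<phi>]] p \<phi>
    by (simp add: idem_map_def compose_def)
qed

text \<open>The whole space is one of the closed sets intersected in the support.\<close>

lemma idem_supp_subset_topspace:
  assumes "\<mu> \<in> idem_measures T"
  shows "idem_supp T \<mu> \<subseteq> topspace T"
proof -
  have "idem_map T T id \<mu> = \<mu>"
  proof (rule extensionalityI)
    show "\<mu> \<in> extensional (cont_funs T)"
      using assms by (simp add: idem_measures_def)
    show "idem_map T T id \<mu> \<in> extensional (cont_funs T)"
      by (simp add: idem_map_def)
    show "idem_map T T id \<mu> \<phi> = \<mu> \<phi>" if "\<phi> \<in> cont_funs T" for \<phi>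
      using that cont_funs_restrict[OF that] by (simp add: idem_map_def compose_def)
  qed
  then have "\<mu> \<in> idem_measures_in T (topspace T)"
    unfolding idem_measures_in_def using assms by (metis imageI subtopology_topspace)
  then show ?thesis
    unfolding idem_supp_def by blast
qed

section \<open>Max-plus combinations of Dirac measures\<close>

text \<open>
  The supremum of the functionals \<open>c + \<delta>\<^sub>p\<close> over pairs \<open>(c, p)\<close>. A set of pairs encodes a density
  function by real weights alone, and the same set serves as data on a subspace.
\<close>

definition max_plus_measure :: "'a topology \<Rightarrow> (real \<times> 'a) set \<Rightarrow> ('a \<Rightarrow> real) \<Rightarrow> real" where
  "max_plus_measure T S = (\<lambda>\<phi>\<in>cont_funs T. SUP (c, p)\<in>S. c + \<phi> p)"

text \<open>Weights at most \<open>0\<close> with \<open>0\<close> attained: the max-plus form of total mass one.\<close>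

definition max_plus_data :: "'a topology \<Rightarrow> (real \<times> 'a) set \<Rightarrow> bool" where
  "max_plus_data T S \<longleftrightarrow> S \<subseteq> {..0} \<times> topspace T \<and> (\<exists>p. (0, p) \<in> S)"

text \<open>
  The suprema are finite because \<open>\<phi>\<close> is bounded and the weights are nonpositive. Being determined by
  its upper bounds, \<open>max_plus_measure\<close> is handled only through this equivalence below.
\<close>

lemma max_plus_measure_le_iff:
  assumes "compact_space T" "max_plus_data T S" "\<phi> \<in> cont_funs T"
  shows "max_plus_measure T S \<phi> \<le> b \<longleftrightarrow> (\<forall>(c, p)\<in>S. c + \<phi> p \<le> b)"
proof -
  obtain B where "\<forall>x\<in>topspace T. \<phi> x \<le> B"
    using cont_funs_bounded_above[OF assms(1,3)] by blast
  then have "bdd_above ((\<lambda>(c, p). c + \<phi> p) ` S)"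
    using assms(2) unfolding max_plus_data_def by (intro bdd_aboveI[of _ B]) fastforce
  moreover have "S \<noteq> {}"
    using assms(2) unfolding max_plus_data_def by blast
  ultimately show ?thesis
    using assms(3) unfolding max_plus_measure_def by (simp add: cSUP_le_iff case_prod_beta)
qed

lemma max_plus_measure_idem:
  assumes T: "compact_space T" and S: "max_plus_data T S"
  shows "max_plus_measure T S \<in> idem_measures T"
proof -
  have S': "c \<le> 0" "p \<in> topspace T" if "(c, p) \<in> S" for c p
    using S that unfolding max_plus_data_def by auto
  obtain p0 where p0: "(0, p0) \<in> S"
    using S unfolding max_plus_data_def by blast
  note le_iff = max_plus_measure_le_iff[OF T S]
  have const: "max_plus_measure T S (\<lambda>x\<in>topspace T. k) = k" for k
  proof -
    have k: "(\<lambda>x\<in>topspace T. k) \<in> cont_funs T"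
      by (rule restrict_mem_cont_funs) simp
    have "max_plus_measure T S (\<lambda>x\<in>topspace T. k) \<le> b \<longleftrightarrow> k \<le> b" for b
      unfolding le_iff[OF k] using S' p0 by fastforce
    then show ?thesis
      using order_antisym by blast
  qed
  have add: "max_plus_measure T S (\<lambda>x\<in>topspace T. k + \<phi> x) = k + max_plus_measure T S \<phi>"
    if \<phi>: "\<phi> \<in> cont_funs T" for k \<phi>
  proof -
    have k: "(\<lambda>x\<in>topspace T. k + \<phi> x) \<in> cont_funs T"
      by (intro restrict_mem_cont_funs continuous_intros cont_funs_continuous \<phi>) simp
    have "max_plus_measure T S (\<lambda>x\<in>topspace T. k + \<phi> x) \<le> b \<longleftrightarrow>
        (\<forall>(c, p)\<in>S. c + \<phi> p \<le> b - k)" for b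
      unfolding le_iff[OF k] using S' by (intro ball_cong) auto
    also have "(\<forall>(c, p)\<in>S. c + \<phi> p \<le> b - k) \<longleftrightarrow> k + max_plus_measure T S \<phi> \<le> b" for b
      unfolding le_iff[OF \<phi>, symmetric] by auto
    finally show ?thesis
      using order_antisym by blast
  qed
  have max: "max_plus_measure T S (\<lambda>x\<in>topspace T. max (\<phi> x) (\<psi> x))
      = max (max_plus_measure T S \<phi>) (max_plus_measure T S \<psi>)"
    if \<phi>: "\<phi> \<in> cont_funs T" and \<psi>: "\<psi> \<in> cont_funs T" for \<phi> \<psi>
  proof -
    have m: "(\<lambda>x\<in>topspace T. max (\<phi> x) (\<psi> x)) \<in> cont_funs T"
      by (intro restrict_mem_cont_funs continuous_intros cont_funs_continuous \<phi> \<psi>)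
    have "max_plus_measure T S (\<lambda>x\<in>topspace T. max (\<phi> x) (\<psi> x)) \<le> b \<longleftrightarrow>
        (\<forall>(c, p)\<in>S. c + \<phi> p \<le> b) \<and> (\<forall>(c, p)\<in>S. c + \<psi> p \<le> b)" for b
    proof -
      have "c + (\<lambda>x\<in>topspace T. max (\<phi> x) (\<psi> x)) p \<le> b \<longleftrightarrow> c + \<phi> p \<le> b \<and> c + \<psi> p \<le> b"
        if "(c, p) \<in> S" for c p
        using S'(2)[OF that] by auto
      then show ?thesis
        unfolding le_iff[OF m] by fast
    qed
    also have "((\<forall>(c, p)\<in>S. c + \<phi> p \<le> b) \<and> (\<forall>(c, p)\<in>S. c + \<psi> p \<le> b)) \<longleftrightarrow>
        max (max_plus_measure T S \<phi>) (max_plus_measure T S \<psi>) \<le> b" for b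
      unfolding le_iff[OF \<phi>, symmetric] le_iff[OF \<psi>, symmetric] by simp
    finally show ?thesis
      using order_antisym by blast
  qed
  show ?thesis
    unfolding idem_measures_def using const add max by (simp add: max_plus_measure_def)
qed

lemma idem_map_max_plus_measure:
  assumes "continuous_map Y X f" "max_plus_data Y S"
  shows "idem_map Y X f (max_plus_measure Y S) = max_plus_measure X (map_prod id f ` S)"
proof -
  have "(SUP (c, p)\<in>S. c + compose (topspace Y) \<psi> f p) = (SUP (c, p)\<in>map_prod id f ` S. c + \<psi> p)"
    for \<psi> :: "_ \<Rightarrow> real"
    unfolding image_image
    by (rule SUP_cong) (use assms(2) in \<open>auto simp: max_plus_data_def compose_def\<close>)
  then show ?thesis
    unfolding idem_map_def max_plus_measure_def[of X]
    by (intro restrict_ext) (simp add: max_plus_measure_def[of Y] cont_funs_compose[OF assms(1)])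
qed

text \<open>The same data, read on the subspace \<open>A\<close>, define a measure there that extends to the given one.\<close>

lemma max_plus_measure_supp:
  assumes T: "compact_space T" and S: "max_plus_data T S"
    and A: "closedin T A" "S \<subseteq> UNIV \<times> A"
  shows "idem_supp T (max_plus_measure T S) \<subseteq> A"
proof -
  have S': "max_plus_data (subtopology T A) S"
    using S A(2) unfolding max_plus_data_def by auto
  have "compact_space (subtopology T A)"
    using T A(1) closedin_compact_space compact_space_subtopology by blast
  then have "max_plus_measure (subtopology T A) S \<in> idem_measures (subtopology T A)"
    using S' by (rule max_plus_measure_idem)
  moreover have "idem_map (subtopology T A) T id (max_plus_measure (subtopology T A) S)
      = max_plus_measure T S"
    using idem_map_max_plus_measure[OF continuous_map_from_subtopology[OF continuous_map_id] S']
    by (simp only: map_prod.id image_id id_apply)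
  ultimately have "max_plus_measure T S \<in> idem_measures_in T A"
    unfolding idem_measures_in_def by (metis imageI)
  then show ?thesis
    unfolding idem_supp_def using A(1) by blast
qed

lemma dirac_eq_max_plus_measure: "dirac T x = max_plus_measure T {(0, x)}"
  by (simp add: dirac_def max_plus_measure_def cong: restrict_cong)

section \<open>Comparison of superlevel sets on a compact metric space\<close>

locale compact_metric = Metric_space M d
  for M :: "'a set" and d :: "'a \<Rightarrow> 'a \<Rightarrow> real" +
  assumes compact: "compact_space mtopology"
begin

abbreviation "T \<equiv> mtopology"
abbreviation "T2 \<equiv> prod_topology mtopology mtopology"

lemma compact_T2: "compact_space T2"
  using compact by (simp add: compact_space_prod_topology)

lemma completely_regular_T2: "completely_regular_space T2"
  using metrizable_space_mtopology
  by (simp add: metrizable_imp_completely_regular_space metrizable_space_prod_topology)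

lemma continuous_map_dist: "continuous_map T2 euclideanreal (\<lambda>(x, y). d x y)"
  using continuous_map_metric[of "metric (M, d)"] by (simp add: mtopology_of_def Metric_space_axioms)

lemma continuous_map_dist_from:
  assumes "a \<in> M" shows "continuous_map T euclideanreal (d a)"
  using continuous_on_mdist[of a "metric (M, d)"] assms by (simp add: mtopology_of_def)

lemma bounded_dist: "\<exists>B. \<forall>x\<in>M. \<forall>y\<in>M. d x y \<le> B"
proof -
  obtain B where B: "\<forall>p\<in>topspace T2. (restrict (\<lambda>(x, y). d x y) (topspace T2)) p \<le> B"
    using cont_funs_bounded_above[OF compact_T2 restrict_mem_cont_funs[OF continuous_map_dist]] by blast
  then have "\<forall>x\<in>M. \<forall>y\<in>M. d x y \<le> B"
    by fastforce
  then show ?thesis ..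
qed

lemma closedin_dist_le: "closedin T2 {p \<in> topspace T2. (\<lambda>(x, y). d x y) p \<in> {..r}}"
  by (rule closedin_continuous_map_preimage[OF continuous_map_dist]) auto

text \<open>
  Every superlevel set of the density of \<open>\<mu>\<close> lies in the \<open>r\<close>-neighbourhood of the corresponding
  superlevel set of the density of \<open>\<nu>\<close>. This is one half of a Hausdorff distance bound, uniform in the
  level.
\<close>

definition dominated_within :: "real \<Rightarrow> (('a \<Rightarrow> real) \<Rightarrow> real) \<Rightarrow> (('a \<Rightarrow> real) \<Rightarrow> real) \<Rightarrow> bool" where
  "dominated_within r \<mu> \<nu> \<longleftrightarrow>
    (\<forall>x c. density_ge T \<mu> x c \<longrightarrow> (\<exists>y. d x y \<le> r \<and> density_ge T \<nu> y c))"

lemma density_ge_carrier: "density_ge T \<mu> x c \<Longrightarrow> x \<in> M"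
  using density_ge_topspace by force

lemma dominated_within_refl: "dominated_within 0 \<mu> \<mu>"
  unfolding dominated_within_def
proof (intro allI impI)
  fix x c assume "density_ge T \<mu> x c"
  then show "\<exists>y. d x y \<le> 0 \<and> density_ge T \<mu> y c"
    by (intro exI[of _ x]) (simp add: density_ge_carrier)
qed

lemma dominated_within_trans:
  assumes "dominated_within r \<mu> \<nu>" "dominated_within s \<nu> \<kappa>"
  shows "dominated_within (r + s) \<mu> \<kappa>"
  unfolding dominated_within_def
proof (intro allI impI)
  fix x c assume x: "density_ge T \<mu> x c"
  then obtain y where y: "d x y \<le> r" "density_ge T \<nu> y c"
    using assms(1) unfolding dominated_within_def by blast
  then obtain z where z: "d y z \<le> s" "density_ge T \<kappa> z c"
    using assms(2) unfolding dominated_within_def by blast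
  have "d x z \<le> d x y + d y z"
    by (intro triangle density_ge_carrier[OF x] density_ge_carrier[OF y(2)] density_ge_carrier[OF z(2)])
  then show "\<exists>z. d x z \<le> r + s \<and> density_ge T \<kappa> z c"
    using y(1) z by (intro exI[of _ z]) auto
qed

text \<open>All levels are nonpositive, and \<open>\<nu>\<close> has a point of density \<open>0\<close>, which serves for all of them.\<close>

lemma dominated_within_diam:
  assumes B: "\<forall>x\<in>M. \<forall>y\<in>M. d x y \<le> B" and \<mu>: "\<mu> \<in> idem_measures T" and \<nu>: "\<nu> \<in> idem_measures T"
  shows "dominated_within B \<mu> \<nu>"
  unfolding dominated_within_def
proof (intro allI impI)
  fix x c assume x: "density_ge T \<mu> x c"
  obtain y where y: "density_ge T \<nu> y 0"
    using density_ge_zero_exists[OF compact \<nu>] by blast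
  then have "density_ge T \<nu> y c"
    using density_ge_nonpos[OF \<mu> x] by (rule density_ge_mono)
  then show "\<exists>y. d x y \<le> B \<and> density_ge T \<nu> y c"
    using B density_ge_carrier[OF x] density_ge_carrier[OF y] by blast
qed

text \<open>
  Superlevel sets are closed: near \<open>x\<close> there are points where the density of \<open>\<nu>\<close> is at least \<open>c\<close>, and
  the inequality \<open>c + \<phi> y \<le> \<nu> \<phi>\<close> passes to the limit \<open>y \<rightarrow> x\<close> by continuity of \<open>\<phi>\<close>.
\<close>

lemma dominated_within_all_imp_density_ge:
  assumes dom: "\<And>r. r > 0 \<Longrightarrow> dominated_within r \<mu> \<nu>" and x: "density_ge T \<mu> x c"
  shows "density_ge T \<nu> x c"
  unfolding density_ge_def
proof (intro conjI ballI)
  show xT: "x \<in> topspace T" using density_ge_topspace[OF x] .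
  fix \<phi> assume \<phi>: "\<phi> \<in> cont_funs T"
  show "c + \<phi> x \<le> \<nu> \<phi>"
  proof (rule field_le_epsilon)
    fix e :: real assume "e > 0"
    have "openin T {y \<in> topspace T. \<phi> y \<in> {\<phi> x - e<..}}"
      by (rule openin_continuous_map_preimage[OF cont_funs_continuous[OF \<phi>]]) auto
    moreover have "x \<in> {y \<in> topspace T. \<phi> y \<in> {\<phi> x - e<..}}"
      using xT \<open>e > 0\<close> by simp
    ultimately obtain r where r: "r > 0" "mball x r \<subseteq> {y \<in> topspace T. \<phi> y \<in> {\<phi> x - e<..}}"
      unfolding openin_mtopology by blast
    have "dominated_within (r / 2) \<mu> \<nu>"
      using dom r(1) by simp
    then obtain y where y: "d x y \<le> r / 2" "density_ge T \<nu> y c"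
      using x unfolding dominated_within_def by blast
    then have "y \<in> mball x r"
      using density_ge_topspace[OF y(2)] xT r(1) by simp
    then show "c + \<phi> x \<le> \<nu> \<phi> + e"
      using r(2) density_geD[OF y(2) \<phi>] by fastforce
  qed
qed

section \<open>Couplings and domination\<close>

text \<open>
  A point of the image measure of density at least \<open>c\<close> is approximated by images of points of density
  at least \<open>c\<close>. Testing against the peak \<open>\<phi> = - n d(x, \<cdot>)\<close> with steep slope \<open>n\<close> forces this: a
  maximiser \<open>p\<close> of the density plus \<open>\<phi> \<circ> f\<close> has density at least \<open>c + n d(x, f p)\<close>, and densities are at most
  \<open>0\<close>, so \<open>d(x, f p) \<le> -c / n\<close>.
\<close>

lemma density_ge_lift:
  assumes S: "compact_space S" and f: "continuous_map S T f" and \<xi>: "\<xi> \<in> idem_measures S"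
    and x: "density_ge T (idem_map S T f \<xi>) x c" and "e > 0"
  shows "\<exists>p. density_ge S \<xi> p c \<and> d x (f p) \<le> e"
proof -
  have xM: "x \<in> M"
    using density_ge_carrier[OF x] .
  define n where "n = (\<bar>c\<bar> + 1) / e"
  have n: "n > 0" "- c \<le> n * e"
    using \<open>e > 0\<close> by (auto simp: n_def)
  define \<phi> where "\<phi> = (\<lambda>z\<in>topspace T. - n * d x z)"
  have \<phi>: "\<phi> \<in> cont_funs T"
    unfolding \<phi>_def
    by (intro restrict_mem_cont_funs continuous_intros continuous_map_dist_from[OF xM]) auto
  let ?\<phi>f = "compose (topspace S) \<phi> f"
  obtain p where p: "density_ge S \<xi> p (\<xi> ?\<phi>f - ?\<phi>f p)"
    using idem_measure_attained[OF S \<xi> cont_funs_compose[OF f \<phi>]] by blast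
  have "f p \<in> topspace T"
    using density_ge_topspace[OF p] continuous_map_image_subset_topspace[OF f] by blast
  then have p': "density_ge S \<xi> p (\<xi> ?\<phi>f + n * d x (f p))"
    using p density_ge_topspace[OF p] by (simp add: compose_def \<phi>_def)
  have c: "c \<le> \<xi> ?\<phi>f"
    using density_geD[OF x \<phi>] xM \<phi> by (simp add: idem_map_def) (simp add: \<phi>_def)
  have "0 \<le> n * d x (f p)"
    using n(1) by simp
  then have "density_ge S \<xi> p c"
    using density_ge_mono[OF p'] c by simp
  moreover have "n * d x (f p) \<le> n * e"
    using density_ge_nonpos[OF \<xi> p'] c n(2) by linarith
  then have "d x (f p) \<le> e"
    using n(1) by simp
  ultimately show ?thesis by blast
qed

text \<open>
  The coupling has density \<open>min (\<lambda>\<^sub>\<mu> x) (\<lambda>\<^sub>\<nu> y)\<close> on \<open>{d \<le> r}\<close>, given here by all weights \<open>c\<close> below that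
  minimum. Its marginals are bounded by \<open>\<mu>\<close> and \<open>\<nu>\<close> by construction, and they reach them because
  each point of either density has a partner of the same level within distance \<open>r\<close>.
\<close>

lemma coupling_exists:
  assumes \<mu>: "\<mu> \<in> idem_measures T" and \<nu>: "\<nu> \<in> idem_measures T"
    and dom: "dominated_within r \<mu> \<nu>" "dominated_within r \<nu> \<mu>"
  shows "\<exists>\<xi>\<in>couplings T \<mu> \<nu>. \<forall>(x, y)\<in>idem_supp T2 \<xi>. d x y \<le> r"
proof -
  define S where "S = {(c, x, y). d x y \<le> r \<and> density_ge T \<mu> x c \<and> density_ge T \<nu> y c}"
  obtain x0 where x0: "density_ge T \<mu> x0 0"
    using density_ge_zero_exists[OF compact \<mu>] by blast
  then obtain y0 where "d x0 y0 \<le> r" "density_ge T \<nu> y0 0"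
    using dom(1) unfolding dominated_within_def by blast
  then have "(0, x0, y0) \<in> S"
    using x0 by (simp add: S_def)
  moreover have "S \<subseteq> {..0} \<times> topspace T2"
    using density_ge_carrier density_ge_nonpos[OF \<mu>] by (auto simp: S_def)
  ultimately have S: "max_plus_data T2 S"
    unfolding max_plus_data_def by blast
  let ?\<xi> = "max_plus_measure T2 S"
  have \<xi>: "?\<xi> \<in> idem_measures T2"
    by (rule max_plus_measure_idem[OF compact_T2 S])
  \<comment> \<open>One argument for both projections: points of \<open>S\<close> stay below the density of \<open>\<kappa>\<close>, and every
    level of that density comes from \<open>S\<close>.\<close>
  have marginal: "idem_map T2 T f ?\<xi> = \<kappa>"
    if f: "continuous_map T2 T f" and \<kappa>: "\<kappa> \<in> idem_measures T"
      and le: "\<And>c p. (c, p) \<in> S \<Longrightarrow> density_ge T \<kappa> (f p) c"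
      and ex: "\<And>x c. density_ge T \<kappa> x c \<Longrightarrow> \<exists>p. (c, p) \<in> S \<and> f p = x"
    for f \<kappa>
  proof (rule extensionalityI)
    show "idem_map T2 T f ?\<xi> \<in> extensional (cont_funs T)"
      by (simp add: idem_map_def)
    show "\<kappa> \<in> extensional (cont_funs T)"
      using \<kappa> by (simp add: idem_measures_def)
    fix \<phi> assume \<phi>: "\<phi> \<in> cont_funs T"
    let ?\<psi> = "compose (topspace T2) \<phi> f"
    have \<psi>: "?\<psi> p = \<phi> (f p)" if "(c, p) \<in> S" for c p
      using S that unfolding max_plus_data_def by (auto simp: compose_def)
    note le_iff = max_plus_measure_le_iff[OF compact_T2 S cont_funs_compose[OF f \<phi>]]
    have "?\<xi> ?\<psi> \<le> \<kappa> \<phi>"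
      unfolding le_iff using density_geD[OF le \<phi>] \<psi> by auto
    moreover obtain x where "density_ge T \<kappa> x (\<kappa> \<phi> - \<phi> x)"
      using idem_measure_attained[OF compact \<kappa> \<phi>] by blast
    then obtain p where "(\<kappa> \<phi> - \<phi> x, p) \<in> S" "f p = x"
      using ex by blast
    then have "\<kappa> \<phi> \<le> ?\<xi> ?\<psi>"
      using le_iff[of "?\<xi> ?\<psi>"] \<psi> by fastforce
    ultimately show "idem_map T2 T f ?\<xi> \<phi> = \<kappa> \<phi>"
      using \<phi> by (simp add: idem_map_def)
  qed
  have "idem_map T2 T fst ?\<xi> = \<mu>"
  proof (rule marginal[OF continuous_map_fst \<mu>])
    fix x c assume x: "density_ge T \<mu> x c"
    then obtain y where "d x y \<le> r" "density_ge T \<nu> y c"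
      using dom(1) unfolding dominated_within_def by blast
    then show "\<exists>p. (c, p) \<in> S \<and> fst p = x"
      using x by (intro exI[of _ "(x, y)"]) (simp add: S_def)
  qed (auto simp: S_def)
  moreover have "idem_map T2 T snd ?\<xi> = \<nu>"
  proof (rule marginal[OF continuous_map_snd \<nu>])
    fix y c assume y: "density_ge T \<nu> y c"
    then obtain x where "d y x \<le> r" "density_ge T \<mu> x c"
      using dom(2) unfolding dominated_within_def by blast
    then show "\<exists>p. (c, p) \<in> S \<and> snd p = y"
      using y by (intro exI[of _ "(x, y)"]) (simp add: S_def commute[of x y])
  qed (auto simp: S_def)
  moreover have "idem_supp T2 ?\<xi> \<subseteq> {p \<in> topspace T2. (\<lambda>(x, y). d x y) p \<in> {..r}}"
    by (rule max_plus_measure_supp[OF compact_T2 S closedin_dist_le])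
      (auto simp: S_def dest: density_ge_carrier)
  ultimately show ?thesis
    using \<xi> unfolding couplings_def by (intro bexI[of _ ?\<xi>]) auto
qed

text \<open>
  A point of \<open>\<mu>\<close> lifts, up to an error, to a point \<open>(x', y)\<close> of \<open>\<xi>\<close> of the same level; it lies in the
  support, so \<open>d(x', y) \<le> s\<close>, and \<open>y\<close> has at least that level for \<open>\<nu>\<close>. The gap \<open>r - s\<close> absorbs the error,
  which costs nothing since the metric is an infimum.
\<close>

lemma coupling_dominated_within:
  assumes \<xi>: "\<xi> \<in> couplings T \<mu> \<nu>" and s: "\<forall>(x, y)\<in>idem_supp T2 \<xi>. d x y \<le> s" and "s < r"
  shows "dominated_within r \<mu> \<nu>" "dominated_within r \<nu> \<mu>"
proof -
  have \<xi>I: "\<xi> \<in> idem_measures T2"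
    and marg: "\<mu> = idem_map T2 T fst \<xi>" "\<nu> = idem_map T2 T snd \<xi>"
    using \<xi> unfolding couplings_def by auto
  have p: "d (fst p) (snd p) \<le> s" "density_ge T \<mu> (fst p) c" "density_ge T \<nu> (snd p) c"
      "fst p \<in> M" "snd p \<in> M"
    if p: "density_ge T2 \<xi> p c" for p c
    using s density_ge_imp_supp[OF completely_regular_T2 p] density_ge_topspace[OF p]
      density_ge_idem_map[OF continuous_map_fst p] density_ge_idem_map[OF continuous_map_snd p]
    unfolding marg by auto
  have e: "r - s > 0"
    using \<open>s < r\<close> by simp
  show "dominated_within r \<mu> \<nu>"
    unfolding dominated_within_def
  proof (intro allI impI)
    fix x c assume x: "density_ge T \<mu> x c"
    obtain q where q: "density_ge T2 \<xi> q c" "d x (fst q) \<le> r - s"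
      using density_ge_lift[OF compact_T2 continuous_map_fst \<xi>I x[unfolded marg] e] by blast
    have "d x (snd q) \<le> d x (fst q) + d (fst q) (snd q)"
      by (intro triangle density_ge_carrier[OF x] p(4,5)[OF q(1)])
    then show "\<exists>y. d x y \<le> r \<and> density_ge T \<nu> y c"
      using p(1,3)[OF q(1)] q(2) by (intro exI[of _ "snd q"]) auto
  qed
  show "dominated_within r \<nu> \<mu>"
    unfolding dominated_within_def
  proof (intro allI impI)
    fix y c assume y: "density_ge T \<nu> y c"
    obtain q where q: "density_ge T2 \<xi> q c" "d y (snd q) \<le> r - s"
      using density_ge_lift[OF compact_T2 continuous_map_snd \<xi>I y[unfolded marg] e] by blast
    have "d y (fst q) \<le> d y (snd q) + d (fst q) (snd q)"
      using triangle[OF density_ge_carrier[OF y] p(5)[OF q(1)] p(4)[OF q(1)]]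
      by (simp add: commute)
    then show "\<exists>x. d y x \<le> r \<and> density_ge T \<mu> x c"
      using p(1,2)[OF q(1)] q(2) by (intro exI[of _ "fst q"]) auto
  qed
qed

section \<open>The metric on idempotent measures\<close>

abbreviation "supp_cost \<xi> \<equiv> SUP (x, y) \<in> idem_supp T2 \<xi>. max (\<xi> (\<lambda>(x, y) \<in> M \<times> M. d x y)) (d x y)"

text \<open>
  At a maximiser \<open>p\<close> of the density of \<open>\<xi>\<close> plus \<open>d\<close>, nonpositivity of the density gives
  \<open>\<xi>(d) \<le> d p\<close>, and \<open>p\<close> belongs to the support: \<open>\<xi>(d)\<close> is dominated by a value of \<open>d\<close> there. The maximiser also shows that the support is nonempty, so that the supremum is a genuine one.
\<close>

lemma supp_cost_le_iff:
  assumes \<xi>: "\<xi> \<in> idem_measures T2"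
  shows "supp_cost \<xi> \<le> r \<longleftrightarrow> (\<forall>(x, y)\<in>idem_supp T2 \<xi>. d x y \<le> r)"
proof -
  let ?dist = "\<lambda>(x, y) \<in> M \<times> M. d x y"
  have "?dist \<in> cont_funs T2"
    using restrict_mem_cont_funs[OF continuous_map_dist] by simp
  then obtain p where p: "density_ge T2 \<xi> p (\<xi> ?dist - ?dist p)"
    using idem_measure_attained[OF compact_T2 \<xi>] by blast
  have p_supp: "p \<in> idem_supp T2 \<xi>"
    by (rule density_ge_imp_supp[OF completely_regular_T2 p])
  have supp_sub: "idem_supp T2 \<xi> \<subseteq> M \<times> M"
    using idem_supp_subset_topspace[OF \<xi>] by simp
  have \<xi>_le: "\<xi> ?dist \<le> d (fst p) (snd p)"
    using density_ge_nonpos[OF \<xi> p] p_supp supp_sub by (auto simp: case_prod_beta)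
  obtain B where "\<forall>x\<in>M. \<forall>y\<in>M. d x y \<le> B"
    using bounded_dist by blast
  then have "bdd_above ((\<lambda>(x, y). max (\<xi> ?dist) (d x y)) ` idem_supp T2 \<xi>)"
    using supp_sub by (intro bdd_aboveI[of _ "max (\<xi> ?dist) B"]) fastforce
  then have "supp_cost \<xi> \<le> r \<longleftrightarrow> (\<forall>(x, y)\<in>idem_supp T2 \<xi>. max (\<xi> ?dist) (d x y) \<le> r)"
    using p_supp by (subst cSUP_le_iff) (auto simp del: restrict_apply)
  also have "\<dots> \<longleftrightarrow> (\<forall>(x, y)\<in>idem_supp T2 \<xi>. d x y \<le> r)"
    using p_supp \<xi>_le by (force simp del: restrict_apply)
  finally show ?thesis .
qed

lemma rho_I_eq:
  assumes "\<mu> \<in> idem_measures T" "\<nu> \<in> idem_measures T"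
  shows "rho_I M d \<mu> \<nu> = (INF \<xi>\<in>couplings T \<mu> \<nu>. supp_cost \<xi>)"
  using assms by (simp add: rho_I_def Let_def)

lemma supp_cost_nonneg:
  assumes \<xi>: "\<xi> \<in> idem_measures T2" shows "0 \<le> supp_cost \<xi>"
proof -
  obtain p where "density_ge T2 \<xi> p 0"
    using density_ge_zero_exists[OF compact_T2 \<xi>] by blast
  then have "p \<in> idem_supp T2 \<xi>"
    by (rule density_ge_imp_supp[OF completely_regular_T2])
  moreover have "\<forall>(x, y)\<in>idem_supp T2 \<xi>. d x y \<le> supp_cost \<xi>"
    using supp_cost_le_iff[OF \<xi>] by blast
  ultimately have "d (fst p) (snd p) \<le> supp_cost \<xi>"
    by (auto simp: case_prod_beta simp del: restrict_apply)
  then show ?thesis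
    using nonneg[of "fst p" "snd p"] by linarith
qed

lemma couplings_idem: "\<xi> \<in> couplings T \<mu> \<nu> \<Longrightarrow> \<xi> \<in> idem_measures T2"
  by (simp add: couplings_def)

text \<open>With the diameter as \<open>r\<close>, the condition for the existence of a coupling always holds.\<close>

lemma couplings_nonempty:
  assumes "\<mu> \<in> idem_measures T" "\<nu> \<in> idem_measures T"
  shows "couplings T \<mu> \<nu> \<noteq> {}"
proof -
  obtain B where "\<forall>x\<in>M. \<forall>y\<in>M. d x y \<le> B"
    using bounded_dist by blast
  then have "dominated_within B \<mu> \<nu>" "dominated_within B \<nu> \<mu>"
    using dominated_within_diam assms by auto
  then show ?thesis
    using coupling_exists[OF assms] by blast
qed

lemma rho_I_nonneg: "0 \<le> rho_I M d \<mu> \<nu>"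
proof (cases "\<mu> \<in> idem_measures T \<and> \<nu> \<in> idem_measures T")
  case True
  then show ?thesis
    using couplings_nonempty supp_cost_nonneg[OF couplings_idem]
    by (subst rho_I_eq) (auto intro!: cINF_greatest simp del: restrict_apply)
next
  case False
  then show ?thesis
    by (auto simp: rho_I_def Let_def)
qed

lemma rho_I_leI:
  assumes \<mu>: "\<mu> \<in> idem_measures T" and \<nu>: "\<nu> \<in> idem_measures T"
    and "dominated_within r \<mu> \<nu>" "dominated_within r \<nu> \<mu>"
  shows "rho_I M d \<mu> \<nu> \<le> r"
proof -
  obtain \<xi> where \<xi>: "\<xi> \<in> couplings T \<mu> \<nu>" "\<forall>(x, y)\<in>idem_supp T2 \<xi>. d x y \<le> r"
    using coupling_exists[OF assms] by blast
  have "bdd_below (supp_cost ` couplings T \<mu> \<nu>)"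
    using supp_cost_nonneg[OF couplings_idem] by (intro bdd_belowI[of _ 0]) blast
  then have "rho_I M d \<mu> \<nu> \<le> supp_cost \<xi>"
    unfolding rho_I_eq[OF \<mu> \<nu>] using \<xi>(1) by (rule cINF_lower)
  then show ?thesis
    using supp_cost_le_iff[OF couplings_idem[OF \<xi>(1)]] \<xi>(2) order_trans by blast
qed

lemma rho_I_less_imp_dominated_within:
  assumes \<mu>: "\<mu> \<in> idem_measures T" and \<nu>: "\<nu> \<in> idem_measures T"
    and less: "rho_I M d \<mu> \<nu> < r"
  shows "dominated_within r \<mu> \<nu>" "dominated_within r \<nu> \<mu>"
proof -
  obtain \<xi> where \<xi>: "\<xi> \<in> couplings T \<mu> \<nu>" "supp_cost \<xi> < r"
    using cInf_lessD[OF _ less[unfolded rho_I_eq[OF \<mu> \<nu>]]] couplings_nonempty[OF \<mu> \<nu>] by blast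
  have "\<forall>(x, y)\<in>idem_supp T2 \<xi>. d x y \<le> supp_cost \<xi>"
    using supp_cost_le_iff[OF couplings_idem[OF \<xi>(1)]] by blast
  then show "dominated_within r \<mu> \<nu>" "dominated_within r \<nu> \<mu>"
    using coupling_dominated_within[OF \<xi>(1) _ \<xi>(2)] by auto
qed

theorem rho_I_metric: "Metric_space (idem_measures T) (rho_I M d)"
proof
  fix \<mu> \<nu> show "0 \<le> rho_I M d \<mu> \<nu>"
    by (rule rho_I_nonneg)
  have le: "rho_I M d \<mu> \<nu> \<le> rho_I M d \<nu> \<mu>"
    if "\<mu> \<in> idem_measures T" "\<nu> \<in> idem_measures T" for \<mu> \<nu>
  proof (rule dense_ge)
    fix r assume "rho_I M d \<nu> \<mu> < r"
    then show "rho_I M d \<mu> \<nu> \<le> r"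
      using rho_I_leI[OF that] rho_I_less_imp_dominated_within[OF that(2,1)] by simp
  qed
  show "rho_I M d \<mu> \<nu> = rho_I M d \<nu> \<mu>"
  proof (cases "\<mu> \<in> idem_measures T \<and> \<nu> \<in> idem_measures T")
    case True
    then show ?thesis
      using le by (simp add: order_antisym)
  next
    case False
    then show ?thesis
      by (auto simp: rho_I_def Let_def)
  qed
next
  fix \<mu> \<nu> assume \<mu>: "\<mu> \<in> idem_measures T" and \<nu>: "\<nu> \<in> idem_measures T"
  show "rho_I M d \<mu> \<nu> = 0 \<longleftrightarrow> \<mu> = \<nu>"
  proof
    assume "rho_I M d \<mu> \<nu> = 0"
    then have "dominated_within r \<mu> \<nu>" "dominated_within r \<nu> \<mu>" if "r > 0" for r
      using rho_I_less_imp_dominated_within[OF \<mu> \<nu>] that by auto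
    then show "\<mu> = \<nu>"
      using dominated_within_all_imp_density_ge by (intro idem_measure_eqI[OF compact \<mu> \<nu>]) blast
  next
    assume "\<mu> = \<nu>"
    then show "rho_I M d \<mu> \<nu> = 0"
      using rho_I_leI[OF \<mu> \<nu>] dominated_within_refl rho_I_nonneg by (intro order_antisym) auto
  qed
next
  fix \<mu> \<nu> \<kappa>
  assume \<mu>: "\<mu> \<in> idem_measures T" and \<nu>: "\<nu> \<in> idem_measures T" and \<kappa>: "\<kappa> \<in> idem_measures T"
  show "rho_I M d \<mu> \<kappa> \<le> rho_I M d \<mu> \<nu> + rho_I M d \<nu> \<kappa>"
  proof (rule field_le_epsilon)
    fix e :: real assume "e > 0"
    define r s where "r = rho_I M d \<mu> \<nu> + e / 2" and "s = rho_I M d \<nu> \<kappa> + e / 2"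
    have r: "dominated_within r \<mu> \<nu>" "dominated_within r \<nu> \<mu>"
      using rho_I_less_imp_dominated_within[OF \<mu> \<nu>] \<open>e > 0\<close> by (auto simp: r_def)
    have s: "dominated_within s \<nu> \<kappa>" "dominated_within s \<kappa> \<nu>"
      using rho_I_less_imp_dominated_within[OF \<nu> \<kappa>] \<open>e > 0\<close> by (auto simp: s_def)
    have "rho_I M d \<mu> \<kappa> \<le> r + s"
      using dominated_within_trans[OF r(1) s(1)] dominated_within_trans[OF s(2) r(2)]
      by (intro rho_I_leI[OF \<mu> \<kappa>]) (simp_all add: add.commute)
    then show "rho_I M d \<mu> \<kappa> \<le> rho_I M d \<mu> \<nu> + rho_I M d \<nu> \<kappa> + e"
      by (simp add: r_def s_def)
  qed
qed

section \<open>Dirac measures\<close>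

lemma dirac_idem: "x \<in> M \<Longrightarrow> dirac T x \<in> idem_measures T"
  unfolding dirac_eq_max_plus_measure
  by (rule max_plus_measure_idem[OF compact]) (simp add: max_plus_data_def)

text \<open>
  At \<open>p \<noteq> x\<close> the density of \<open>\<delta>\<^sub>x\<close> is \<open>-\<infinity>\<close>: multiples of \<open>d(x, \<cdot>)\<close> vanish at \<open>x\<close> and can be made
  arbitrarily large at \<open>p\<close>.
\<close>

lemma density_ge_dirac_iff:
  assumes x: "x \<in> M"
  shows "density_ge T (dirac T x) p c \<longleftrightarrow> p = x \<and> c \<le> 0"
proof
  assume p: "density_ge T (dirac T x) p c"
  have c: "c \<le> 0"
    by (rule density_ge_nonpos[OF dirac_idem[OF x] p])
  have "p = x"
  proof (rule ccontr)
    assume "p \<noteq> x"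
    then have pos: "d x p > 0"
      using x density_ge_carrier[OF p] mdist_pos_less by metis
    let ?f = "\<lambda>z. (1 - c) / d x p * d x z"
    have f: "continuous_map T euclideanreal ?f"
      by (intro continuous_intros continuous_map_dist_from[OF x]) auto
    have "c + ?f p \<le> dirac T x (restrict ?f (topspace T))"
      by (rule density_ge_continuous_map[OF p f])
    then show False
      using pos x restrict_mem_cont_funs[OF f] by (simp add: dirac_def)
  qed
  with c show "p = x \<and> c \<le> 0" by simp
next
  assume "p = x \<and> c \<le> 0"
  then show "density_ge T (dirac T x) p c"
    using x by (auto simp: density_ge_def dirac_def)
qed

lemma dominated_within_dirac_iff:
  assumes "x \<in> M" "y \<in> M"
  shows "dominated_within r (dirac T x) (dirac T y) \<longleftrightarrow> d x y \<le> r"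
  unfolding dominated_within_def density_ge_dirac_iff[OF assms(1)] density_ge_dirac_iff[OF assms(2)]
  by (metis order_refl)

theorem rho_I_dirac:
  assumes "x \<in> M" "y \<in> M"
  shows "rho_I M d (dirac T x) (dirac T y) = d x y"
proof (rule order_antisym)
  note I = dirac_idem[OF assms(1)] dirac_idem[OF assms(2)]
  show "rho_I M d (dirac T x) (dirac T y) \<le> d x y"
    using assms by (intro rho_I_leI[OF I]) (simp_all add: dominated_within_dirac_iff commute[of y x])
  show "d x y \<le> rho_I M d (dirac T x) (dirac T y)"
  proof (rule dense_ge)
    fix r assume "rho_I M d (dirac T x) (dirac T y) < r"
    then show "d x y \<le> r"
      using rho_I_less_imp_dominated_within(1)[OF I] dominated_within_dirac_iff[OF assms] by simp
  qed
qed

end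

theorem theorem1:
  fixes X :: "'a set" and \<rho> :: "'a \<Rightarrow> 'a \<Rightarrow> real"
  assumes "Metric_space X \<rho>"
    and "compact_space (Metric_space.mtopology X \<rho>)"
  shows "Metric_space (idem_measures (Metric_space.mtopology X \<rho>)) (rho_I X \<rho>) \<and>
    (\<forall>x\<in>X. \<forall>y\<in>X.
       rho_I X \<rho> (dirac (Metric_space.mtopology X \<rho>) x) (dirac (Metric_space.mtopology X \<rho>) y) = \<rho> x y)"
proof -
  interpret compact_metric X \<rho>
    using assms by (simp add: compact_metric_def compact_metric_axioms_def)
  show ?thesis
    using rho_I_metric rho_I_dirac by blast
qed

end
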